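(* Let $V:\mathbb{R}^d\to\mathbb{R}^d$, $V(x)=Mx+v$, be an affine operator with $M\in\mathbb{R}^{d\times d}$, $M\ne0$, $v\in\mathbb{R}^d$, and nonempty solution set $\mathcal{X}^*=\{x:V(x)=0\}$, such that $\langle V(x),x-x^*\rangle\ge0$ for all $x\in\mathbb{R}^d$, $x^*\in\mathcal{X}^*$. Let $L$ be the largest singular value of $M$ and $\tau$ the smallest nonzero singular value of $M$. Suppose that for some $\sigma\ge0$ and all $t\in\{1,3/2,2,\dots\}$ the oracle noise satisfies $\mathbb{E}[Z_t\mid\mathcal{F}_t]=0$ and $\mathbb{E}[\|Z_t\|^2\mid\mathcal{F}_t]\le\sigma^2$. Take a constant exploration stepsize $\gamma_t\equiv\gamma$ with $0<\gamma\le c/L$, where $0<c<1$. For $\eta>0$ put $$C=\eta^2(1+c^2)\sigma^2,\qquad\Delta=\gamma\eta\tau^2(1-c^2).$$ Then the iterates $X_t$ ($t$ integer) of the double stepsize extragradient algorithm satisfy: 1. If the update stepsize is constant, $\eta_t\equiv\eta\le\gamma$, then for all $t$ $$\mathbb{E}[\mathrm{dist}(X_t,\mathcal{X}^* )^2]\le(1-\Delta)^{t-1}\,\mathrm{dist}(X_1,\mathcal{X}^* )^2+\frac{C}{\Delta}.$$ 2. If the update stepsize is $\eta_t=\eta/(t+b)$ with $\eta>1/(\tau^2\gamma(1-c^2))$ and $b>\eta/\gamma$, then $$\mathbb{E}[\mathrm{dist}(X_t,\mathcal{X}^* )^2]\le\frac{C}{\Delta-1}\,\frac1t+o\!\lef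t(\frac1t\right).$$
   Context: The double stepsize extragradient (DSEG) algorithm is, for integers $t=1,2,\dots$, $$X_{t+1/2}=X_t-\gamma_t\hat V_t,\qquad X_{t+1}=X_t-\eta_t\hat V_{t+1/2},$$ started at a (deterministic) $X_1\in\mathbb{R}^d$. For each $t\in\{1,3/2,2,\dots\}$ the stochastic oracle returns $\hat V_t=V(X_t)+Z_t$, where $Z_t$ is an additive random noise vector. $\mathcal{F}_t$ denotes the history (natural filtration), i.e. the $\sigma$-algebra generated by $X_s$, $s\le t$, $s\in\{1,3/2,2,\dots\}$. $\|\cdot\|$ is the Euclidean norm and $\mathrm{dist}(x,\mathcal{X}^* )=\inf_{x^*\in\mathcal{X}^*}\|x-x^*\|$. *)

theory Defs
  imports "HOL-Probability.Probability" "HOL-Library.Landau_Symbols"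
begin

definition singular_values :: "real ^ 'n ^ 'm \<Rightarrow> real set" where
  "singular_values A =
     {s. 0 \<le> s \<and> (\<exists>x. x \<noteq> 0 \<and> (transpose A ** A) *v x = s\<^sup>2 *\<^sub>R x)}"

text \<open>
  Finiteness makes \<open>Max\<close> and \<open>Min\<close> below meaningful: eigenvectors of the symmetric matrix
  \<open>transpose A ** A\<close> for distinct eigenvalues are orthogonal.
\<close>

lemma finite_singular_values: "finite (singular_values A)"
proof -
  let ?B = "transpose A ** A"
  have "\<forall>s\<in>singular_values A. \<exists>x. x \<noteq> 0 \<and> ?B *v x = s\<^sup>2 *\<^sub>R x"
    by (auto simp: singular_values_def)
  then obtain f where f: "\<And>s. s \<in> singular_values A \<Longrightarrow> f s \<noteq> 0"
    "\<And>s. s \<in> singular_values A \<Longrightarrow> ?B *v f s = s\<^sup>2 *\<^sub>R f s"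
    by metis
  have sym: "(?B *v x) \<bullet> y = x \<bullet> (?B *v y)" for x y
    by (metis dot_lmul_matrix matrix_transpose_mul transpose_matrix_vector transpose_transpose)
  have orth: "f s \<bullet> f t = 0"
    if "s \<in> singular_values A" "t \<in> singular_values A" "s \<noteq> t" for s t
  proof -
    have "s\<^sup>2 * (f s \<bullet> f t) = t\<^sup>2 * (f s \<bullet> f t)"
      using sym[of "f s" "f t"] f that by simp
    moreover have "s\<^sup>2 \<noteq> t\<^sup>2"
      using that by (auto simp: singular_values_def power2_eq_iff)
    ultimately show ?thesis by simp
  qed
  have inj: "inj_on f (singular_values A)"
    using orth f by (metis inj_onI inner_eq_zero_iff)
  have "pairwise orthogonal (f ` singular_values A)"
    using orth by (auto simp: pairwise_def orthogonal_def)
  then have "independent (f ` singular_values A)"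
    using f by (intro pairwise_orthogonal_independent) auto
  then have "finite (f ` singular_values A)"
    using independent_bound by blast
  then show ?thesis
    using inj finite_imageD by blast
qed

definition largest_singular_value :: "real ^ 'n ^ 'm \<Rightarrow> real" where
  "largest_singular_value A = Max (singular_values A)"

definition smallest_nonzero_singular_value :: "real ^ 'n ^ 'm \<Rightarrow> real" where
  "smallest_nonzero_singular_value A = Min (singular_values A - {0})"

definition half_steps :: "real set" where
  "half_steps = {1 + real k / 2 | k :: nat. True}"

definition history ::
  "'a measure \<Rightarrow> (real \<Rightarrow> 'a \<Rightarrow> 'b::topological_space) \<Rightarrow> real \<Rightarrow> 'a measure" where
  "history P X t =
     sigma (space P) {X s -` A \<inter> space P | s A. s \<in> half_steps \<and> s \<le> t \<and> A \<in> sets borel}"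

text \<open>The library has conditional expectations of real-valued functions only, so the conditional
  expectation of a random vector is taken componentwise.\<close>

definition vec_cond_exp ::
  "'a measure \<Rightarrow> 'a measure \<Rightarrow> ('a \<Rightarrow> real ^ 'n) \<Rightarrow> 'a \<Rightarrow> real ^ 'n" where
  "vec_cond_exp P F Z \<omega> = (\<chi> i. real_cond_exp P F (\<lambda>\<omega>'. Z \<omega>' $ i) \<omega>)"

text \<open>The second moment bound is stated for \<open>[0, \<infinity>]\<close>-valued conditional expectations, so it
  forces the noise to be square integrable instead of presupposing it.\<close>

definition oracle_noise ::
  "'a measure \<Rightarrow> (real \<Rightarrow> 'a measure) \<Rightarrow> real \<Rightarrow> (real \<Rightarrow> 'a \<Rightarrow> real ^ 'n) \<Rightarrow> bool" where
  "oracle_noise P F \<sigma> Z \<longleftrightarrow>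
     (\<forall>t\<in>half_steps.
        Z t \<in> borel_measurable P \<and>
        (AE \<omega> in P. vec_cond_exp P (F t) (Z t) \<omega> = 0) \<and>
        (AE \<omega> in P. nn_cond_exp P (F t) (\<lambda>\<omega>'. ennreal ((norm (Z t \<omega>'))\<^sup>2)) \<omega> \<le> ennreal (\<sigma>\<^sup>2)))"

text \<open>\<open>\<gamma>\<close> and \<open>\<eta>\<close> are the exploration and update stepsizes, \<open>x1\<close> is the deterministic starting
  point, and \<open>V (X t \<omega>) + Z t \<omega>\<close> is the answer of the stochastic oracle at time \<open>t\<close>.\<close>

definition dseg ::
  "'a measure \<Rightarrow> ('b \<Rightarrow> 'b) \<Rightarrow> (real \<Rightarrow> 'a \<Rightarrow> 'b) \<Rightarrow> (nat \<Rightarrow> real) \<Rightarrow> (nat \<Rightarrow> real) \<Rightarrow> 'b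
    \<Rightarrow> (real \<Rightarrow> 'a \<Rightarrow> 'b::real_normed_vector) \<Rightarrow> bool" where
  "dseg P V Z \<gamma> \<eta> x1 X \<longleftrightarrow>
     (\<forall>\<omega>\<in>space P.
        X 1 \<omega> = x1 \<and>
        (\<forall>t::nat. t \<ge> 1 \<longrightarrow>
           X (real t + 1/2) \<omega> = X (real t) \<omega> - \<gamma> t *\<^sub>R (V (X (real t) \<omega>) + Z (real t) \<omega>) \<and>
           X (real t + 1) \<omega> =
             X (real t) \<omega> - \<eta> t *\<^sub>R (V (X (real t + 1/2) \<omega>) + Z (real t + 1/2) \<omega>)))"

end

theory Submission
  imports Defs "HOL-Real_Asymp.Real_Asymp"
begin

text \<open>
  Write \<open>u\<close> for the difference of an iterate and its projection onto \<open>S\<close>. Since \<open>S\<close> is a translate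
  of the kernel of \<open>M\<close>, \<open>u\<close> is orthogonal to that kernel, so \<open>\<tau> * norm u \<le> norm (M *v u)\<close>; and
  the field value at the iterate is \<open>M *v u\<close>. For an affine field the hypothesis on the
  displacements from zeros of \<open>V\<close> means that \<open>M\<close> is monotone. Without noise, one step with update stepsize \<open>e \<le> \<gamma>\<close>
  therefore decreases \<open>(norm u)\<^sup>2\<close> by at least \<open>\<gamma> * e * (1 - c\<^sup>2) * (norm (M *v u))\<^sup>2\<close>
  (\<open>extragradient_step_decrease\<close>), hence contracts the squared distance to \<open>S\<close> by the factor
  \<open>1 - \<gamma> * e * \<tau>\<^sup>2 * (1 - c\<^sup>2)\<close>.

  Because \<open>V\<close> is affine, the exploration noise enters the new iterate only through a linear map of
  norm at most \<open>e * c\<close>, so its conditional centering survives the second oracle call. The two noise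
  terms are thus orthogonal in mean square to what precedes them and add
  \<open>e\<^sup>2 * (1 + c\<^sup>2) * \<sigma>\<^sup>2\<close> to the expected squared distance (\<open>expected_dist_step\<close>).

  Both rates come from the resulting scalar recursion. For a constant stepsize it is a geometric
  recursion with fixed point \<open>C / \<Delta>\<close>. For the stepsize \<open>\<eta> / (t + b)\<close> it has the factor
  \<open>1 - \<Delta> / (t + b)\<close> and the additive term \<open>C / (t + b)\<^sup>2\<close>; the excess over the supersolution
  \<open>C / (\<Delta> - 1) * (1 / (t + b))\<close> is \<open>O((t + b) powr - \<Delta>)\<close>, which is \<open>o(1 / t)\<close> because
  \<open>\<Delta> > 1\<close> (\<open>harmonic_recursion_bound\<close>).
\<close>

section \<open>Singular values as extremal stretching factors\<close>

lemma selfadjoint_maximizer_is_eigenvector: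
  fixes B :: "'a::euclidean_space \<Rightarrow> 'a"
  assumes lin: "linear B" and adj: "\<And>x y. B x \<bullet> y = x \<bullet> B y"
    and W: "subspace W" and inv: "\<And>x. x \<in> W \<Longrightarrow> B x \<in> W" and nontriv: "W \<noteq> {0}"
  obtains x where "x \<in> W" "norm x = 1" "B x = (x \<bullet> B x) *\<^sub>R x"
    "\<And>y. y \<in> W \<Longrightarrow> y \<bullet> B y \<le> (x \<bullet> B x) * (norm y)\<^sup>2"
proof -
  interpret B: linear B by (rule lin)
  have "compact (W \<inter> sphere 0 1)"
    using closed_subspace[OF W] by (simp add: closed_Int_compact)
  moreover obtain w where w: "w \<in> W" "w \<noteq> 0"
    using nontriv subspace_0[OF W] by blast
  then have "(1 / norm w) *\<^sub>R w \<in> W \<inter> sphere 0 1"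
    using subspace_scale[OF W] by simp
  then have "W \<inter> sphere 0 1 \<noteq> {}" by blast
  moreover have "continuous_on (W \<inter> sphere 0 1) (\<lambda>y. y \<bullet> B y)"
    using lin by (intro continuous_on_inner continuous_on_id linear_continuous_on)
       (simp add: linear_conv_bounded_linear)
  ultimately obtain x where x: "x \<in> W \<inter> sphere 0 1"
    and max: "\<And>y. y \<in> W \<inter> sphere 0 1 \<Longrightarrow> y \<bullet> B y \<le> x \<bullet> B x"
    using continuous_attains_sup by metis
  define l where "l = x \<bullet> B x"
  have le: "y \<bullet> B y \<le> l * (norm y)\<^sup>2" if "y \<in> W" for y
  proof (cases "y = 0")
    case False
    have "(1 / norm y) *\<^sub>R y \<in> W \<inter> sphere 0 1"
      using that False subspace_scale[OF W] by simp
    from max[OF this] have "(y \<bullet> B y) / (norm y)\<^sup>2 \<le> l"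
      by (simp add: B.scale l_def power2_eq_square)
    then show ?thesis using False by (simp add: divide_le_eq mult.commute)
  qed (simp add: B.zero)
  define h where "h = B x - l *\<^sub>R x"
  have hW: "h \<in> W"
    using x inv W unfolding h_def by (auto intro: subspace_diff subspace_scale)
  have x1: "norm x = 1" "x \<bullet> x = 1" using x by (auto simp: norm_eq_1)
  have hx: "h \<bullet> x = 0"
    using x1 by (simp add: h_def inner_diff_left inner_diff_right inner_commute l_def)
  \<comment> \<open>Up to a factor \<open>2\<close>, the residual \<open>h\<close> is the gradient at \<open>x\<close> of the form
     \<open>y \<bullet> B y - l * (norm y)\<^sup>2\<close>, which is at most \<open>0\<close> on \<open>W\<close> and vanishes at \<open>x\<close>; so for
     \<open>h \<noteq> 0\<close> a short step along \<open>h\<close> would make the form positive.\<close>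
  have quad: "2 * s * (h \<bullet> h) + s\<^sup>2 * (h \<bullet> B h - l * (h \<bullet> h)) \<le> 0" for s :: real
  proof -
    have "x + s *\<^sub>R h \<in> W"
      using x hW W by (auto intro: subspace_add subspace_scale)
    from le[OF this]
    have "(x + s *\<^sub>R h) \<bullet> B (x + s *\<^sub>R h) \<le> l * ((x + s *\<^sub>R h) \<bullet> (x + s *\<^sub>R h))"
      by (simp add: power2_norm_eq_inner)
    moreover have "h \<bullet> B x = h \<bullet> h"
      using hx by (simp add: h_def inner_diff_right inner_diff_left inner_commute)
    moreover have "x \<bullet> B h = h \<bullet> B x"
      using adj[of x h] by (simp add: inner_commute)
    ultimately show ?thesis
      using x1 hx
      by (simp add: B.add B.scale inner_add_left inner_add_right l_def[symmetric]
          inner_commute[of x h] power2_eq_square algebra_simps)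
  qed
  have "h \<bullet> h = 0"
  proof (rule ccontr)
    assume "h \<bullet> h \<noteq> 0"
    then have pos: "h \<bullet> h > 0" using inner_ge_zero[of h] by linarith
    define q where "q = \<bar>h \<bullet> B h - l * (h \<bullet> h)\<bar> + 1"
    have q: "q > 0" "h \<bullet> B h - l * (h \<bullet> h) \<ge> - q" unfolding q_def by auto
    define s where "s = (h \<bullet> h) / q"
    have s: "s > 0" "s * q = h \<bullet> h" using q pos unfolding s_def by auto
    have "s\<^sup>2 * (h \<bullet> B h - l * (h \<bullet> h)) \<ge> s\<^sup>2 * (- q)"
      using q(2) by (intro mult_left_mono) auto
    moreover have "s\<^sup>2 * (- q) = - (s * (h \<bullet> h))"
      using s(2) by (simp add: power2_eq_square algebra_simps)
    moreover have "s * (h \<bullet> h) > 0" using s pos by simp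
    ultimately show False using quad[of s] by linarith
  qed
  then have "B x = l *\<^sub>R x" by (simp add: h_def)
  then show thesis using that[of x] x le x1 unfolding l_def by auto
qed

lemma gram_inner: "x \<bullet> ((transpose A ** A) *v y) = (A *v x) \<bullet> (A *v y)"
  for A :: "real^'n^'m"
  by (metis dot_lmul_matrix matrix_vector_mul_assoc transpose_matrix_vector inner_commute)

lemma gram_selfadjoint:
  "((transpose A ** A) *v x) \<bullet> y = x \<bullet> ((transpose A ** A) *v y)" for A :: "real^'n^'m"
  by (metis gram_inner inner_commute)

lemma gram_eigenvector_singular_value:
  fixes A :: "real^'n^'m"
  assumes "norm x = 1" "(transpose A ** A) *v x = l *\<^sub>R x"
  shows "l = (norm (A *v x))\<^sup>2" "norm (A *v x) \<in> singular_values A"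
proof -
  show l: "l = (norm (A *v x))\<^sup>2"
    using gram_inner[of x A x] assms by (simp add: power2_norm_eq_inner norm_eq_1)
  show "norm (A *v x) \<in> singular_values A"
    unfolding singular_values_def using assms l by (auto intro!: exI[of _ x])
qed

lemma largest_singular_value_bounds:
  fixes A :: "real^'n^'m"
  shows norm_mult_le_largest_singular_value: "norm (A *v y) \<le> largest_singular_value A * norm y"
    and largest_singular_value_nonneg: "0 \<le> largest_singular_value A"
proof -
  have "(axis undefined 1 :: real^'n) \<noteq> 0" by (simp add: axis_eq_0_iff)
  then have ne: "UNIV \<noteq> {0 :: real^'n}" by blast
  obtain x :: "real^'n" where x: "norm x = 1"
      "(transpose A ** A) *v x = (x \<bullet> ((transpose A ** A) *v x)) *\<^sub>R x"
      "\<And>y. y \<bullet> ((transpose A ** A) *v y) \<le> (x \<bullet> ((transpose A ** A) *v x)) * (norm y)\<^sup>2"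
    by (rule selfadjoint_maximizer_is_eigenvector[of "\<lambda>x. (transpose A ** A) *v x" UNIV])
       (auto simp: gram_selfadjoint ne)
  note sv = gram_eigenvector_singular_value[OF x(1,2)]
  have le: "norm (A *v x) \<le> largest_singular_value A"
    unfolding largest_singular_value_def using sv(2) finite_singular_values by (intro Max_ge)
  then show nn: "0 \<le> largest_singular_value A" using norm_ge_zero order_trans by blast
  have "(norm (A *v y))\<^sup>2 \<le> (norm (A *v x) * norm y)\<^sup>2"
    using x(3)[of y] by (simp add: gram_inner power2_norm_eq_inner power_mult_distrib)
  then have "norm (A *v y) \<le> norm (A *v x) * norm y"
    by (rule power2_le_imp_le) simp
  also have "\<dots> \<le> largest_singular_value A * norm y"
    using le by (intro mult_right_mono) auto
  finally show "norm (A *v y) \<le> largest_singular_value A * norm y" .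
qed

text \<open>
  The Gram matrix leaves the orthogonal complement of the kernel invariant, so its smallest
  Rayleigh quotient on that complement is again an eigenvalue, and it is nonzero. Negating the
  form turns this minimum into the maximum treated above.
\<close>

lemma smallest_nonzero_singular_value_bounds:
  fixes A :: "real^'n^'m"
  assumes "A \<noteq> 0"
  shows smallest_nonzero_singular_value_pos: "0 < smallest_nonzero_singular_value A"
    and smallest_nonzero_singular_value_le:
      "(\<And>k. A *v k = 0 \<Longrightarrow> y \<bullet> k = 0)
        \<Longrightarrow> smallest_nonzero_singular_value A * norm y \<le> norm (A *v y)"
    and smallest_nonzero_singular_value_le_largest:
      "smallest_nonzero_singular_value A \<le> largest_singular_value A"
proof -
  let ?G = "transpose A ** A"
  let ?s = "smallest_nonzero_singular_value A"
  define W where "W = {y. \<forall>k. A *v k = 0 \<longrightarrow> y \<bullet> k = 0}"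
  have W: "subspace W" unfolding W_def subspace_def by (auto simp: inner_add_left)
  have inv: "?G *v y \<in> W" for y
    unfolding W_def using gram_inner[of y A]
    by (auto simp: gram_selfadjoint gram_inner)
  have "W \<noteq> {0}"
  proof
    assume triv: "W = {0}"
    have "A *v y = 0" for y
    proof -
      have "?G *v y = 0" using inv[of y] triv by simp
      then have "(A *v y) \<bullet> (A *v y) = 0" using gram_inner[of y A y] by simp
      then show ?thesis by simp
    qed
    then have "A = 0" by (simp add: matrix_eq)
    with assms show False ..
  qed
  then obtain x where x: "x \<in> W" "norm x = 1"
      "- (?G *v x) = (x \<bullet> - (?G *v x)) *\<^sub>R x"
      "\<And>y. y \<in> W \<Longrightarrow> y \<bullet> - (?G *v y) \<le> (x \<bullet> - (?G *v x)) * (norm y)\<^sup>2"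
    by (rule selfadjoint_maximizer_is_eigenvector[of "\<lambda>x. - (?G *v x)" W, rotated 4])
       (auto simp: W inv gram_selfadjoint linear_compose_neg subspace_neg)
  have "?G *v x = (x \<bullet> (?G *v x)) *\<^sub>R x" using x(3) by simp
  note sv = gram_eigenvector_singular_value[OF x(2) this]
  have "A *v x \<noteq> 0" using x(1,2) unfolding W_def by (auto simp: norm_eq_1)
  then have mem: "norm (A *v x) \<in> singular_values A - {0}" using sv(2) by simp
  have fin: "finite (singular_values A - {0})" using finite_singular_values by blast
  have s: "?s \<in> singular_values A - {0}"
    unfolding smallest_nonzero_singular_value_def using fin mem by (intro Min_in) auto
  then show "0 < ?s" by (auto simp: singular_values_def)
  show "?s \<le> largest_singular_value A"
    unfolding largest_singular_value_def using s finite_singular_values by (intro Max_ge) auto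
  have le: "?s \<le> norm (A *v x)"
    unfolding smallest_nonzero_singular_value_def using fin mem by (intro Min_le)
  show "?s * norm y \<le> norm (A *v y)" if "\<And>k. A *v k = 0 \<Longrightarrow> y \<bullet> k = 0"
  proof -
    have "y \<in> W" using that unfolding W_def by auto
    from x(4)[OF this] have "(norm (A *v x) * norm y)\<^sup>2 \<le> (norm (A *v y))\<^sup>2"
      by (simp add: gram_inner power2_norm_eq_inner power_mult_distrib)
    then have "norm (A *v x) * norm y \<le> norm (A *v y)"
      by (rule power2_le_imp_le) simp
    moreover have "?s * norm y \<le> norm (A *v x) * norm y"
      using le by (intro mult_right_mono) auto
    ultimately show ?thesis by linarith
  qed
qed

section \<open>The noiseless extragradient step\<close>

text \<open>
  Monotonicity is used at the exploration point \<open>u - \<gamma> *\<^sub>R M u\<close>: it bounds the progress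
  \<open>u \<bullet> M (u - \<gamma> *\<^sub>R M u)\<close> from below by \<open>\<gamma>\<close> times the inner product of the two field values
  \<open>M u\<close> and \<open>M (u - \<gamma> *\<^sub>R M u)\<close>. These are close to each other because \<open>\<gamma> * L \<le> c\<close>, so their
  inner product controls both squared norms; one of them pays for the quadratic term of the
  update (this needs \<open>\<eta> \<le> \<gamma>\<close>), the other one is the gain.
\<close>

lemma extragradient_step_decrease:
  fixes M :: "'a::real_inner \<Rightarrow> 'a"
  assumes lin: "linear M" and mono: "\<And>x. 0 \<le> M x \<bullet> x"
    and bound: "\<And>x. norm (M x) \<le> L * norm x"
    and step: "0 \<le> \<gamma>" "\<gamma> * L \<le> c" "0 \<le> \<eta>" "\<eta> \<le> \<gamma>"
  shows "(norm (u - \<eta> *\<^sub>R M (u - \<gamma> *\<^sub>R M u)))\<^sup>2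
           \<le> (norm u)\<^sup>2 - \<gamma> * \<eta> * (1 - c\<^sup>2) * (norm (M u))\<^sup>2"
proof -
  interpret M: linear M by (rule lin)
  define w where "w = M u"
  define q where "q = M (u - \<gamma> *\<^sub>R w)"
  have "norm (w - q) = \<gamma> * norm (M w)"
    using step by (simp add: q_def M.diff M.scale w_def)
  also have "\<dots> \<le> \<gamma> * (L * norm w)" using bound step by (intro mult_left_mono) auto
  also have "\<dots> \<le> c * norm w"
    using mult_right_mono[OF step(2), of "norm w"] by (simp add: mult.assoc)
  finally have "(norm (w - q))\<^sup>2 \<le> (c * norm w)\<^sup>2" by (intro power_mono) auto
  then have close: "2 * (q \<bullet> w) \<ge> (norm q)\<^sup>2 + (1 - c\<^sup>2) * (norm w)\<^sup>2"
    by (simp add: power2_norm_eq_inner inner_diff_left inner_diff_right inner_commute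
        power_mult_distrib algebra_simps)
  have progress: "\<gamma> * (q \<bullet> w) \<le> u \<bullet> q"
    using mono[of "u - \<gamma> *\<^sub>R w"] by (simp add: q_def[symmetric] inner_diff_right inner_commute)
  have "\<eta> * (\<gamma> * ((norm q)\<^sup>2 + (1 - c\<^sup>2) * (norm w)\<^sup>2)) \<le> \<eta> * (\<gamma> * (2 * (q \<bullet> w)))"
    using close step by (intro mult_left_mono) auto
  also have "\<dots> \<le> \<eta> * (2 * (u \<bullet> q))" using progress step by (intro mult_left_mono) auto
  finally have "\<eta> * (\<gamma> * ((norm q)\<^sup>2 + (1 - c\<^sup>2) * (norm w)\<^sup>2)) \<le> 2 * \<eta> * (u \<bullet> q)" by simp
  moreover have "\<eta> * (\<eta> * (norm q)\<^sup>2) \<le> \<eta> * (\<gamma> * (norm q)\<^sup>2)"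
    using step by (intro mult_left_mono mult_right_mono) auto
  moreover have "(norm (u - \<eta> *\<^sub>R q))\<^sup>2 = (norm u)\<^sup>2 - 2 * \<eta> * (u \<bullet> q) + \<eta> * (\<eta> * (norm q)\<^sup>2)"
    by (simp only: power2_norm_eq_inner inner_diff_left inner_diff_right inner_scaleR_left
        inner_scaleR_right inner_commute[of q u]) (simp add: algebra_simps)
  ultimately show ?thesis
    unfolding q_def w_def by (simp add: algebra_simps)
qed

lemma affine_zero_set_projection:
  fixes M :: "real^'n^'n"
  assumes V: "\<And>x. V x = M *v x + v" and S: "S = {x. V x = 0}" "S \<noteq> {}"
  shows affine_zero_set_closed: "closed S"
    and affine_zero_set_convex: "convex S"
    and norm_diff_closest_zero: "norm (x - closest_point S x) = infdist x S"
    and mult_diff_closest_zero: "M *v (x - closest_point S x) = V x"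
    and diff_closest_zero_orthogonal_kernel:
      "M *v k = 0 \<Longrightarrow> (x - closest_point S x) \<bullet> k = 0"
proof -
  have "closed {x. M *v x + v = 0}"
    by (intro closed_Collect_eq continuous_intros)
  then show cl: "closed S" using S V by simp
  show cv: "convex S"
  proof (rule convexI)
    fix x y and a b :: real
    assume *: "x \<in> S" "y \<in> S" "a + b = 1"
    have "M *v (a *\<^sub>R x + b *\<^sub>R y) + v
        = a *\<^sub>R (M *v x + v) + b *\<^sub>R (M *v y + v)"
    proof -
      have "v = a *\<^sub>R v + b *\<^sub>R v" using *(3) by (metis scaleR_add_left scaleR_one)
      then have "M *v (a *\<^sub>R x + b *\<^sub>R y) + v
          = M *v (a *\<^sub>R x + b *\<^sub>R y) + (a *\<^sub>R v + b *\<^sub>R v)" by (rule arg_cong)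
      then show ?thesis
        by (simp only: matrix_vector_right_distrib matrix_vector_mult_scaleR scaleR_add_right add_ac)
    qed
    then show "a *\<^sub>R x + b *\<^sub>R y \<in> S" using * S V by simp
  qed
  have p: "closest_point S x \<in> S" using closest_point_in_set[OF cl S(2)] .
  obtain z where z: "z \<in> S" "infdist x S = dist x z"
    using infdist_attains_inf[OF cl S(2)] by blast
  show "norm (x - closest_point S x) = infdist x S"
    using infdist_le[OF p, of x] closest_point_le[OF cl z(1), of x] z(2) by (simp add: dist_norm)
  show "M *v (x - closest_point S x) = V x"
  proof -
    have "M *v closest_point S x = - v" using p S V by (simp add: eq_neg_iff_add_eq_0)
    then show ?thesis using V by (simp add: matrix_vector_mult_diff_distrib)
  qed
  show "(x - closest_point S x) \<bullet> k = 0" if k: "M *v k = 0"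
  proof -
    have "closest_point S x + k \<in> S" "closest_point S x - k \<in> S"
      using p S V k by (auto simp: matrix_vector_right_distrib matrix_vector_mult_diff_distrib)
    from this[THEN closest_point_dot[OF cv cl], of x] show ?thesis
      by (simp add: inner_diff_right)
  qed
qed

lemma monotone_at_zeros_imp_mult_nonneg:
  fixes M :: "real^'n^'n"
  assumes V: "\<And>x. V x = M *v x + v" and S: "S = {x. V x = 0}" "S \<noteq> {}"
    and mono: "\<And>x xs. xs \<in> S \<Longrightarrow> 0 \<le> V x \<bullet> (x - xs)"
  shows "0 \<le> (M *v y) \<bullet> y"
proof -
  obtain p where p: "p \<in> S" using S(2) by blast
  have "V (p + y) = M *v y"
    using p S(1) V by (simp add: matrix_vector_right_distrib)
  then show ?thesis using mono[OF p, of "p + y"] by simp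
qed

section \<open>Conditionally centered noise\<close>

definition noise_at ::
  "'a measure \<Rightarrow> 'a measure \<Rightarrow> real \<Rightarrow> ('a \<Rightarrow> real ^ 'n) \<Rightarrow> bool" where
  "noise_at P F s Z \<longleftrightarrow>
     Z \<in> borel_measurable P \<and>
     (AE \<omega> in P. vec_cond_exp P F Z \<omega> = 0) \<and>
     (AE \<omega> in P. nn_cond_exp P F (\<lambda>\<omega>'. ennreal ((norm (Z \<omega>'))\<^sup>2)) \<omega> \<le> ennreal (s\<^sup>2))"

lemma noise_at_second_moment:
  fixes Z :: "'a \<Rightarrow> real ^ 'n"
  assumes P: "prob_space P" and sub: "subalgebra P F" and Z: "noise_at P F s Z"
  shows "integrable P (\<lambda>\<omega>. (norm (Z \<omega>))\<^sup>2)"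
    and "(\<integral>\<omega>. (norm (Z \<omega>))\<^sup>2 \<partial>P) \<le> s\<^sup>2"
proof -
  interpret prob_space P by (rule P)
  interpret finite_measure_subalgebra P F by unfold_locales (rule sub)
  have [measurable]: "Z \<in> borel_measurable P" using Z by (simp add: noise_at_def)
  have "(\<integral>\<^sup>+\<omega>. ennreal ((norm (Z \<omega>))\<^sup>2) \<partial>P)
      = (\<integral>\<^sup>+\<omega>. nn_cond_exp P F (\<lambda>\<omega>'. ennreal ((norm (Z \<omega>'))\<^sup>2)) \<omega> \<partial>P)"
    using nn_cond_exp_intg[of "\<lambda>_. 1" "\<lambda>\<omega>. ennreal ((norm (Z \<omega>))\<^sup>2)"] by simp
  also have "\<dots> \<le> (\<integral>\<^sup>+\<omega>. ennreal (s\<^sup>2) \<partial>P)"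
    using Z by (intro nn_integral_mono_AE) (simp add: noise_at_def)
  also have "\<dots> = ennreal (s\<^sup>2)" by (simp add: emeasure_space_1)
  finally have le: "(\<integral>\<^sup>+\<omega>. ennreal ((norm (Z \<omega>))\<^sup>2) \<partial>P) \<le> ennreal (s\<^sup>2)" .
  show int: "integrable P (\<lambda>\<omega>. (norm (Z \<omega>))\<^sup>2)"
    by (rule integrableI_bounded) (use le_less_trans[OF le ennreal_less_top] in simp_all)
  show "(\<integral>\<omega>. (norm (Z \<omega>))\<^sup>2 \<partial>P) \<le> s\<^sup>2"
    using le nn_integral_eq_integral[OF int] by simp
qed

text \<open>
  Coordinate by coordinate, a conditionally centered vector is orthogonal in mean square to every
  vector that is known at the time of the conditioning. So the squared norms of the known part
  and of the noise add up, and there is no cross term.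
\<close>

lemma noise_at_second_moment_add:
  fixes Z :: "'a \<Rightarrow> real ^ 'n" and Y :: "'a \<Rightarrow> 'b::euclidean_space"
  assumes P: "prob_space P" and sub: "subalgebra P F" and Z: "noise_at P F s Z"
    and Y: "Y \<in> borel_measurable F" and Y2: "integrable P (\<lambda>\<omega>. (norm (Y \<omega>))\<^sup>2)"
    and lin: "linear T" and bound: "\<And>z. norm (T z) \<le> K * norm z"
  shows "integrable P (\<lambda>\<omega>. (norm (Y \<omega> + T (Z \<omega>)))\<^sup>2)"
    and "(\<integral>\<omega>. (norm (Y \<omega> + T (Z \<omega>)))\<^sup>2 \<partial>P) \<le> (\<integral>\<omega>. (norm (Y \<omega>))\<^sup>2 \<partial>P) + K\<^sup>2 * s\<^sup>2"
proof -
  interpret prob_space P by (rule P)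
  interpret finite_measure_subalgebra P F by unfold_locales (rule sub)
  interpret T: linear T by (rule lin)
  have Zm[measurable]: "Z \<in> borel_measurable P" using Z by (simp add: noise_at_def)
  have Ym[measurable]: "Y \<in> borel_measurable P" by (rule measurable_from_subalg[OF sub Y])
  have [measurable]: "T \<in> borel_measurable borel"
    by (intro borel_measurable_continuous_onI linear_continuous_on linear_conv_bounded_linear[THEN iffD1] lin)
  note Z2 = noise_at_second_moment[OF P sub Z]
  have Z_comp[measurable]: "(\<lambda>\<omega>. Z \<omega> $ i) \<in> borel_measurable P" for i
    by (rule measurable_compose[OF Zm]) (intro borel_measurable_continuous_onI continuous_intros)
  define y where "y i \<omega> = Y \<omega> \<bullet> T (axis i 1)" for i \<omega>
  have yF[measurable]: "y i \<in> borel_measurable F" for i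
    unfolding y_def using Y by measurable
  have ym[measurable]: "y i \<in> borel_measurable P" for i by (rule measurable_from_subalg[OF sub yF])
  have cross: "Y \<omega> \<bullet> T (Z \<omega>) = (\<Sum>i\<in>UNIV. y i \<omega> * Z \<omega> $ i)" for \<omega>
  proof -
    have "Z \<omega> = (\<Sum>i\<in>UNIV. Z \<omega> $ i *\<^sub>R axis i 1)"
      using basis_expansion[of "Z \<omega>"] by (simp add: scalar_mult_eq_scaleR)
    then have "T (Z \<omega>) = (\<Sum>i\<in>UNIV. Z \<omega> $ i *\<^sub>R T (axis i 1))"
      by (metis (no_types, lifting) T.scale T.sum sum.cong)
    then show ?thesis by (simp add: inner_sum_right y_def mult.commute)
  qed
  have prod_int: "integrable P (\<lambda>\<omega>. y i \<omega> * Z \<omega> $ i)" for i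
  proof (rule Bochner_Integration.integrable_bound)
    show "integrable P (\<lambda>\<omega>. (norm (T (axis i 1)))\<^sup>2 * (norm (Y \<omega>))\<^sup>2 + (norm (Z \<omega>))\<^sup>2)"
      using Y2 Z2 by simp
    have "\<bar>y i \<omega> * Z \<omega> $ i\<bar> \<le> (norm (T (axis i 1)))\<^sup>2 * (norm (Y \<omega>))\<^sup>2 + (norm (Z \<omega>))\<^sup>2" for \<omega>
    proof -
      have "\<bar>y i \<omega> * Z \<omega> $ i\<bar> \<le> (norm (Y \<omega>) * norm (T (axis i 1))) * norm (Z \<omega>)"
        unfolding abs_mult y_def
        by (intro mult_mono Cauchy_Schwarz_ineq2 component_le_norm_cart) auto
      also have "\<dots> \<le> (norm (Y \<omega>) * norm (T (axis i 1)))\<^sup>2 + (norm (Z \<omega>))\<^sup>2"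
      proof -
        define p where "p = norm (Y \<omega>) * norm (T (axis i 1))"
        have "0 \<le> p * norm (Z \<omega>)" unfolding p_def by simp
        then have "p * norm (Z \<omega>) \<le> p\<^sup>2 + (norm (Z \<omega>))\<^sup>2"
          using sum_squares_bound[of p "norm (Z \<omega>)"] by linarith
        then show ?thesis unfolding p_def .
      qed
      finally show ?thesis by (simp add: power_mult_distrib mult.commute)
    qed
    then show "AE \<omega> in P. norm (y i \<omega> * Z \<omega> $ i)
        \<le> norm ((norm (T (axis i 1)))\<^sup>2 * (norm (Y \<omega>))\<^sup>2 + (norm (Z \<omega>))\<^sup>2)"
      by (intro AE_I2) simp
  qed measurable
  have "(\<integral>\<omega>. y i \<omega> * Z \<omega> $ i \<partial>P) = 0" for i
  proof -
    have "(\<integral>\<omega>. y i \<omega> * Z \<omega> $ i \<partial>P) = (\<integral>\<omega>. y i \<omega> * real_cond_exp P F (\<lambda>\<omega>. Z \<omega> $ i) \<omega> \<partial>P)"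
      by (rule real_cond_exp_intg(2)[OF prod_int yF Z_comp, symmetric])
    also have "\<dots> = (\<integral>\<omega>. 0 \<partial>P)"
    proof (rule integral_cong_AE)
      have "AE \<omega> in P. vec_cond_exp P F Z \<omega> = 0" using Z by (simp add: noise_at_def)
      then show "AE \<omega> in P. y i \<omega> * real_cond_exp P F (\<lambda>\<omega>. Z \<omega> $ i) \<omega> = 0"
        by eventually_elim (auto simp: vec_cond_exp_def vec_eq_iff)
    qed measurable
    finally show ?thesis by simp
  qed
  then have cross_int: "integrable P (\<lambda>\<omega>. Y \<omega> \<bullet> T (Z \<omega>))" "(\<integral>\<omega>. Y \<omega> \<bullet> T (Z \<omega>) \<partial>P) = 0"
    unfolding cross using prod_int by (simp_all add: Bochner_Integration.integral_sum)
  have TZ: "(norm (T (Z \<omega>)))\<^sup>2 \<le> K\<^sup>2 * (norm (Z \<omega>))\<^sup>2" for \<omega>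
    using power_mono[OF bound[of "Z \<omega>"], of 2] by (simp add: power_mult_distrib)
  have TZ_int: "integrable P (\<lambda>\<omega>. (norm (T (Z \<omega>)))\<^sup>2)"
    by (rule Bochner_Integration.integrable_bound[of _ "\<lambda>\<omega>. K\<^sup>2 * (norm (Z \<omega>))\<^sup>2"])
       (use Z2 TZ in auto)
  have expand: "(norm (Y \<omega> + T (Z \<omega>)))\<^sup>2
      = (norm (Y \<omega>))\<^sup>2 + 2 * (Y \<omega> \<bullet> T (Z \<omega>)) + (norm (T (Z \<omega>)))\<^sup>2" for \<omega>
    by (simp add: power2_norm_eq_inner inner_add_left inner_add_right inner_commute)
  show "integrable P (\<lambda>\<omega>. (norm (Y \<omega> + T (Z \<omega>)))\<^sup>2)"
    unfolding expand using Y2 cross_int(1) TZ_int by simp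
  have "(\<integral>\<omega>. (norm (T (Z \<omega>)))\<^sup>2 \<partial>P) \<le> (\<integral>\<omega>. K\<^sup>2 * (norm (Z \<omega>))\<^sup>2 \<partial>P)"
    using TZ_int Z2 TZ by (intro integral_mono) auto
  also have "\<dots> \<le> K\<^sup>2 * s\<^sup>2" using Z2 by (simp add: mult_left_mono)
  finally show "(\<integral>\<omega>. (norm (Y \<omega> + T (Z \<omega>)))\<^sup>2 \<partial>P) \<le> (\<integral>\<omega>. (norm (Y \<omega>))\<^sup>2 \<partial>P) + K\<^sup>2 * s\<^sup>2"
    unfolding expand using Y2 cross_int TZ_int by simp
qed

section \<open>One stochastic step\<close>

text \<open>
  The new iterate is compared with the projection of the old one onto \<open>S\<close>. The noise enters
  the new iterate twice: linearly through the update, with factor \<open>\<eta>\<close>, and through \<open>\<eta> * \<gamma>\<close> times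
  \<open>M\<close> from the exploration, with factor at most \<open>\<eta> * c\<close>. Both parts are centered given the
  respective past, so they contribute \<open>\<eta>\<^sup>2 * \<sigma>\<^sup>2\<close> and \<open>\<eta>\<^sup>2 * c\<^sup>2 * \<sigma>\<^sup>2\<close> and no mixed terms. What
  remains is the noiseless step, started at a vector orthogonal to the kernel of \<open>M\<close>, where \<open>\<tau>\<close>
  turns its decrease into a contraction.
\<close>

lemma expected_dist_step:
  fixes M :: "real^'n^'n" and X W X' Z Z' :: "'a \<Rightarrow> real^'n"
  assumes P: "prob_space P"
    and V: "\<And>x. V x = M *v x + v" and S: "S = {x. V x = 0}" "S \<noteq> {}"
    and mono: "\<And>y. 0 \<le> (M *v y) \<bullet> y"
    and L: "\<And>y. norm (M *v y) \<le> L * norm y"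
    and \<tau>: "0 \<le> \<tau>" "\<And>y. (\<And>k. M *v k = 0 \<Longrightarrow> y \<bullet> k = 0) \<Longrightarrow> \<tau> * norm y \<le> norm (M *v y)"
    and c: "0 \<le> c" "c \<le> 1"
    and step: "0 \<le> \<gamma>" "0 \<le> L" "\<gamma> * L \<le> c" "0 \<le> \<eta>" "\<eta> \<le> \<gamma>"
    and sub: "subalgebra P F" "subalgebra P G"
    and meas: "X \<in> borel_measurable F" "X \<in> borel_measurable G" "W \<in> borel_measurable G"
    and noise: "noise_at P F \<sigma> Z" "noise_at P G \<sigma> Z'"
    and W: "\<And>\<omega>. \<omega> \<in> space P \<Longrightarrow> W \<omega> = X \<omega> - \<gamma> *\<^sub>R (V (X \<omega>) + Z \<omega>)"
    and X': "\<And>\<omega>. \<omega> \<in> space P \<Longrightarrow> X' \<omega> = X \<omega> - \<eta> *\<^sub>R (V (W \<omega>) + Z' \<omega>)"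
      "X' \<in> borel_measurable P"
    and int: "integrable P (\<lambda>\<omega>. (infdist (X \<omega>) S)\<^sup>2)"
  shows "integrable P (\<lambda>\<omega>. (infdist (X' \<omega>) S)\<^sup>2)"
    and "(\<integral>\<omega>. (infdist (X' \<omega>) S)\<^sup>2 \<partial>P)
      \<le> (1 - \<gamma> * \<eta> * \<tau>\<^sup>2 * (1 - c\<^sup>2)) * (\<integral>\<omega>. (infdist (X \<omega>) S)\<^sup>2 \<partial>P)
        + \<eta>\<^sup>2 * (1 + c\<^sup>2) * \<sigma>\<^sup>2"
proof -
  note proj = affine_zero_set_projection[OF V S]
  define \<pi> where "\<pi> x = closest_point S x" for x
  define f where "f x = (x - \<pi> x) - \<eta> *\<^sub>R (M *v ((x - \<pi> x) - \<gamma> *\<^sub>R (M *v (x - \<pi> x))))" for x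
  define g where "g x w = (x - \<pi> x) - \<eta> *\<^sub>R V w" for x w
  have \<pi>_cont: "continuous_on UNIV \<pi>"
    unfolding \<pi>_def using proj(1,2) S(2) by (intro continuous_on_closest_point)
  then have [measurable]: "\<pi> \<in> borel_measurable borel" by (rule borel_measurable_continuous_onI)
  have [measurable]: "(\<lambda>x. M *v x) \<in> borel_measurable borel"
    by (intro borel_measurable_continuous_onI continuous_intros)
  have [measurable]: "V \<in> borel_measurable borel" using V by (subst ext[of V, OF V]) measurable
  have [measurable]: "(\<lambda>x. infdist x S) \<in> borel_measurable borel"
    by (intro borel_measurable_continuous_onI continuous_intros)
  have f_meas: "(\<lambda>\<omega>. f (X \<omega>)) \<in> borel_measurable F" unfolding f_def using meas(1) by measurable
  have g_meas: "(\<lambda>\<omega>. g (X \<omega>) (W \<omega>)) \<in> borel_measurable G"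
    unfolding g_def using meas(2,3) by measurable
  have [measurable]: "X' \<in> borel_measurable P" by (rule X'(2))
  have XP[measurable]: "X \<in> borel_measurable P" by (rule measurable_from_subalg[OF sub(1) meas(1)])
  have f_le: "(norm (f x))\<^sup>2 \<le> (1 - \<gamma> * \<eta> * \<tau>\<^sup>2 * (1 - c\<^sup>2)) * (infdist x S)\<^sup>2" for x
  proof -
    define u where "u = x - \<pi> x"
    have u: "norm u = infdist x S" unfolding u_def \<pi>_def by (rule proj(3))
    have "\<tau> * norm u \<le> norm (M *v u)"
      by (rule \<tau>(2)) (simp add: u_def \<pi>_def proj(5))
    then have "(\<tau> * norm u)\<^sup>2 \<le> (norm (M *v u))\<^sup>2" using \<tau>(1) by (intro power_mono) auto
    then have "\<gamma> * \<eta> * (1 - c\<^sup>2) * (\<tau> * norm u)\<^sup>2 \<le> \<gamma> * \<eta> * (1 - c\<^sup>2) * (norm (M *v u))\<^sup>2"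
      using step c by (intro mult_left_mono) (auto simp: power_le_one)
    moreover have "(norm (f x))\<^sup>2 \<le> (norm u)\<^sup>2 - \<gamma> * \<eta> * (1 - c\<^sup>2) * (norm (M *v u))\<^sup>2"
      unfolding f_def u_def[symmetric]
      by (rule extragradient_step_decrease[OF _ mono L]) (use step in auto)
    ultimately show ?thesis unfolding u by (simp add: power_mult_distrib algebra_simps)
  qed
  have f_int: "integrable P (\<lambda>\<omega>. (norm (f (X \<omega>)))\<^sup>2)"
    by (rule Bochner_Integration.integrable_bound
        [of _ "\<lambda>\<omega>. (1 - \<gamma> * \<eta> * \<tau>\<^sup>2 * (1 - c\<^sup>2)) * (infdist (X \<omega>) S)\<^sup>2"])
       (use int f_le measurable_from_subalg[OF sub(1) f_meas] in
         \<open>auto intro!: AE_I2 order_trans[OF f_le abs_ge_self]\<close>)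
  let ?T = "\<lambda>z. (\<eta> * \<gamma>) *\<^sub>R (M *v z)"
  have T: "linear ?T" by (intro linear_compose_scale_right matrix_vector_mul_linear)
  have T_bound: "norm (?T z) \<le> (\<eta> * c) * norm z" for z
  proof -
    have "norm (?T z) \<le> \<eta> * \<gamma> * (L * norm z)"
      using L step by (simp add: mult_left_mono)
    also have "\<dots> = \<eta> * (\<gamma> * L) * norm z" by simp
    also have "\<dots> \<le> \<eta> * c * norm z" using step by (intro mult_right_mono mult_left_mono) auto
    finally show ?thesis .
  qed
  have g_eq: "g (X \<omega>) (W \<omega>) = f (X \<omega>) + ?T (Z \<omega>)" if "\<omega> \<in> space P" for \<omega>
  proof -
    have "V (W \<omega>) = V (X \<omega>) - \<gamma> *\<^sub>R (M *v (V (X \<omega>) + Z \<omega>))"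
      using W[OF that] V by (simp add: matrix_vector_mult_diff_distrib matrix_vector_mult_scaleR)
    also have "\<dots> = M *v ((X \<omega> - \<pi> (X \<omega>)) - \<gamma> *\<^sub>R (M *v (X \<omega> - \<pi> (X \<omega>)))) - \<gamma> *\<^sub>R (M *v Z \<omega>)"
      using proj(4)[of "X \<omega>"] unfolding \<pi>_def[symmetric]
      by (simp add: matrix_vector_mult_diff_distrib[of M "X \<omega> - \<pi> (X \<omega>)"]
          matrix_vector_mult_scaleR matrix_vector_right_distrib scaleR_add_right)
    finally show ?thesis unfolding g_def f_def by (simp add: scaleR_diff_right)
  qed
  note explore = noise_at_second_moment_add[OF P sub(1) noise(1) f_meas f_int T T_bound]
  have g_int: "integrable P (\<lambda>\<omega>. (norm (g (X \<omega>) (W \<omega>)))\<^sup>2)"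
    using explore(1) by (rule Bochner_Integration.integrable_cong[THEN iffD1, OF refl, rotated])
      (simp add: g_eq)
  have g_le: "(\<integral>\<omega>. (norm (g (X \<omega>) (W \<omega>)))\<^sup>2 \<partial>P)
      \<le> (\<integral>\<omega>. (norm (f (X \<omega>)))\<^sup>2 \<partial>P) + (\<eta> * c)\<^sup>2 * \<sigma>\<^sup>2"
    using explore(2)
    by (subst Bochner_Integration.integral_cong[OF refl, of P _ "\<lambda>\<omega>. (norm (f (X \<omega>) + ?T (Z \<omega>)))\<^sup>2"])
       (auto simp: g_eq)
  have U: "linear (\<lambda>z :: real^'n. (- \<eta>) *\<^sub>R z)" by (intro linear_compose_scale_right linear_id[unfolded id_def])
  have U_bound: "norm ((- \<eta>) *\<^sub>R z) \<le> \<eta> * norm z" for z :: "real^'n" using step by simp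
  note update = noise_at_second_moment_add[OF P sub(2) noise(2) g_meas g_int U U_bound]
  have dist_le: "(infdist (X' \<omega>) S)\<^sup>2 \<le> (norm (g (X \<omega>) (W \<omega>) + (- \<eta>) *\<^sub>R Z' \<omega>))\<^sup>2"
    if "\<omega> \<in> space P" for \<omega>
  proof -
    have "\<pi> (X \<omega>) \<in> S" unfolding \<pi>_def by (rule closest_point_in_set[OF proj(1) S(2)])
    then have "infdist (X' \<omega>) S \<le> norm (X' \<omega> - \<pi> (X \<omega>))" using infdist_le by (metis dist_norm)
    also have "X' \<omega> - \<pi> (X \<omega>) = g (X \<omega>) (W \<omega>) + (- \<eta>) *\<^sub>R Z' \<omega>"
      using X'(1)[OF that] by (simp add: g_def scaleR_add_right)
    finally show ?thesis by (intro power_mono) (auto simp: infdist_nonneg)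
  qed
  show int': "integrable P (\<lambda>\<omega>. (infdist (X' \<omega>) S)\<^sup>2)"
  proof (rule Bochner_Integration.integrable_bound[OF update(1)])
    show "(\<lambda>\<omega>. (infdist (X' \<omega>) S)\<^sup>2) \<in> borel_measurable P" by measurable
  qed (use dist_le in auto)
  have "(\<integral>\<omega>. (infdist (X' \<omega>) S)\<^sup>2 \<partial>P) \<le> (\<integral>\<omega>. (norm (g (X \<omega>) (W \<omega>) + (- \<eta>) *\<^sub>R Z' \<omega>))\<^sup>2 \<partial>P)"
    using int' update(1) dist_le by (intro integral_mono) auto
  also have "\<dots> \<le> (\<integral>\<omega>. (norm (f (X \<omega>)))\<^sup>2 \<partial>P) + (\<eta> * c)\<^sup>2 * \<sigma>\<^sup>2 + \<eta>\<^sup>2 * \<sigma>\<^sup>2"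
    using update(2) g_le by linarith
  also have "(\<integral>\<omega>. (norm (f (X \<omega>)))\<^sup>2 \<partial>P)
      \<le> (\<integral>\<omega>. (1 - \<gamma> * \<eta> * \<tau>\<^sup>2 * (1 - c\<^sup>2)) * (infdist (X \<omega>) S)\<^sup>2 \<partial>P)"
    using f_int int f_le by (intro integral_mono) auto
  also have "\<dots> = (1 - \<gamma> * \<eta> * \<tau>\<^sup>2 * (1 - c\<^sup>2)) * (\<integral>\<omega>. (infdist (X \<omega>) S)\<^sup>2 \<partial>P)"
    by (rule integral_mult_right_zero)
  finally show "(\<integral>\<omega>. (infdist (X' \<omega>) S)\<^sup>2 \<partial>P)
      \<le> (1 - \<gamma> * \<eta> * \<tau>\<^sup>2 * (1 - c\<^sup>2)) * (\<integral>\<omega>. (infdist (X \<omega>) S)\<^sup>2 \<partial>P)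
        + \<eta>\<^sup>2 * (1 + c\<^sup>2) * \<sigma>\<^sup>2"
    by (simp add: algebra_simps power_mult_distrib)
qed

section \<open>Measurability of the iterates\<close>

lemma half_steps_cases:
  assumes "s \<in> half_steps"
  obtains t :: nat where "t \<ge> 1" "s = real t" | t :: nat where "t \<ge> 1" "s = real t + 1/2"
proof -
  obtain k :: nat where k: "s = 1 + real k / 2" using assms by (auto simp: half_steps_def)
  show thesis
  proof (cases "even k")
    case True
    then obtain m where "k = 2 * m" by blast
    then show thesis using k that(1)[of "m + 1"] by simp
  next
    case False
    then obtain m where "k = 2 * m + 1" by (auto elim: oddE)
    then show thesis using k that(2)[of "m + 1"] by (simp add: add_divide_distrib)
  qed
qed

lemma nat_in_half_steps:
  assumes "t \<ge> 1"
  shows "real t \<in> half_steps" "real t + 1/2 \<in> half_steps"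
proof -
  have "real t = 1 + real (2 * (t - 1)) / 2" "real t + 1/2 = 1 + real (2 * (t - 1) + 1) / 2"
    using assms by (auto simp: of_nat_diff field_simps)
  then show "real t \<in> half_steps" "real t + 1/2 \<in> half_steps"
    unfolding half_steps_def by blast+
qed

text \<open>
  The recursion that defines the iterates carries over the measurability of the noise, so the
  history is a sub-\<open>\<sigma>\<close>-algebra and conditioning on it is meaningful.
\<close>

lemma dseg_borel_measurable:
  fixes X Z :: "real \<Rightarrow> 'a \<Rightarrow> 'b::euclidean_space"
  assumes dseg: "dseg P V Z \<gamma> \<eta> x1 X" and V[measurable]: "V \<in> borel_measurable borel"
    and Z: "\<And>s. s \<in> half_steps \<Longrightarrow> Z s \<in> borel_measurable P"
    and s: "s \<in> half_steps"
  shows "X s \<in> borel_measurable P"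
proof -
  have half: "X (real t + 1/2) \<in> borel_measurable P"
    if t: "t \<ge> 1" and [measurable]: "X (real t) \<in> borel_measurable P" for t :: nat
  proof -
    have [measurable]: "Z (real t) \<in> borel_measurable P" using Z nat_in_half_steps t by blast
    have "(\<lambda>\<omega>. X (real t) \<omega> - \<gamma> t *\<^sub>R (V (X (real t) \<omega>) + Z (real t) \<omega>)) \<in> borel_measurable P"
      by measurable
    then show ?thesis
      by (rule measurable_cong[THEN iffD1, rotated]) (use dseg t in \<open>auto simp: dseg_def\<close>)
  qed
  have nat: "X (real t) \<in> borel_measurable P" if "t \<ge> 1" for t :: nat
    using that
  proof (induction t rule: dec_induct)
    case base
    have "(\<lambda>_. x1) \<in> borel_measurable P" by simp
    then show ?case
      by (rule measurable_cong[THEN iffD1, rotated]) (use dseg in \<open>auto simp: dseg_def\<close>)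
  next
    case (step t)
    note [measurable] = step.IH half[OF step.hyps(1) step.IH]
    have [measurable]: "Z (real t + 1/2) \<in> borel_measurable P"
      using Z nat_in_half_steps step.hyps by blast
    have "(\<lambda>\<omega>. X (real t) \<omega> - \<eta> t *\<^sub>R (V (X (real t + 1/2) \<omega>) + Z (real t + 1/2) \<omega>))
        \<in> borel_measurable P" by measurable
    then show ?case
      by (rule measurable_cong[THEN iffD1, rotated])
         (use dseg step.hyps in \<open>auto simp: dseg_def add.commute\<close>)
  qed
  from s show ?thesis by (cases rule: half_steps_cases) (use nat half in simp_all)
qed

lemma history_subalgebra:
  fixes X :: "real \<Rightarrow> 'a \<Rightarrow> 'b::topological_space"
  assumes "\<And>s. s \<in> half_steps \<Longrightarrow> X s \<in> borel_measurable P"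
  shows "subalgebra P (history P X t)"
proof -
  let ?G = "{X s -` A \<inter> space P | s A. s \<in> half_steps \<and> s \<le> t \<and> A \<in> sets borel}"
  have "?G \<subseteq> sets P" using assms by (auto intro: measurable_sets)
  then have "sigma_sets (space P) ?G \<subseteq> sets P" by (rule sets.sigma_sets_subset)
  moreover have "?G \<subseteq> Pow (space P)" by blast
  ultimately show ?thesis
    unfolding subalgebra_def history_def by (simp add: sets_measure_of space_measure_of)
qed

lemma borel_measurable_history:
  fixes X :: "real \<Rightarrow> 'a \<Rightarrow> 'b::topological_space"
  assumes "s \<in> half_steps" "s \<le> t"
  shows "X s \<in> borel_measurable (history P X t)"
proof (rule measurableI)
  fix A :: "'b set" assume "A \<in> sets borel"
  then have "X s -` A \<inter> space P
      \<in> {X s -` A \<inter> space P | s A. s \<in> half_steps \<and> s \<le> t \<and> A \<in> sets borel}"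
    using assms by blast
  then show "X s -` A \<inter> space (history P X t) \<in> sets (history P X t)"
    unfolding history_def space_measure_of_conv by (rule in_measure_of[rotated]) blast
qed simp

section \<open>Solving the recursions\<close>

lemma geometric_recursion_bound:
  fixes a :: "nat \<Rightarrow> real"
  assumes "\<And>t. t \<ge> 1 \<Longrightarrow> a (Suc t) \<le> (1 - D) * a t + C"
    and D: "0 < D" "D \<le> 1" and C: "0 \<le> C" and t: "t \<ge> 1"
  shows "a t \<le> (1 - D) ^ (t - 1) * a 1 + C / D"
  using t
proof (induction t rule: dec_induct)
  case base
  then show ?case using C D by simp
next
  case (step t)
  have "a (Suc t) \<le> (1 - D) * ((1 - D) ^ (t - 1) * a 1 + C / D) + C"
    using assms(1)[OF step.hyps(1)] mult_left_mono[OF step.IH, of "1 - D"] D by linarith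
  also have "(1 - D) * ((1 - D) ^ (t - 1) * a 1 + C / D) + C = (1 - D) ^ t * a 1 + C / D"
  proof -
    have "(1 - D) * (C / D) + C = C / D" using D by (simp add: field_simps)
    moreover have "(1 - D) ^ t = (1 - D) * (1 - D) ^ (t - 1)"
      using step.hyps by (cases t) auto
    ultimately show ?thesis by (simp only: distrib_left mult.assoc add.assoc)
  qed
  finally show ?case by simp
qed

text \<open>
  With \<open>A = C / (D - 1)\<close>, the function \<open>A / (t + b)\<close> satisfies the recursion with \<open>\<ge>\<close> in place of
  \<open>\<le>\<close>, because \<open>A * D - C = A\<close>. So the excess over it obeys the homogeneous recursion,
  whose solutions decay like the product of the factors \<open>1 - D / (t + b)\<close>, that is, like
  \<open>(t + b) powr - D\<close>.
\<close>

lemma harmonic_recursion_bound: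
  fixes a :: "nat \<Rightarrow> real"
  assumes rec: "\<And>t. t \<ge> 1 \<Longrightarrow>
      a (Suc t) \<le> (1 - D / (real t + b)) * a t + C / (real t + b)\<^sup>2"
    and D: "1 < D" and nonneg: "\<And>t::nat. t \<ge> 1 \<Longrightarrow> D \<le> real t + b"
    and b: "0 \<le> b" and C: "0 \<le> C" and t: "t \<ge> 1"
  shows "a t \<le> C / (D - 1) * (1 / (real t + b)) + \<bar>a 1\<bar> * ((1 + b) / (real t + b)) powr D"
  using t
proof (induction t rule: dec_induct)
  case base
  have "0 \<le> C / (D - 1) * (1 / (1 + b))" using C D b by simp
  then show ?case using b by simp
next
  case (step t)
  define A where "A = C / (D - 1)"
  define s where "s = real t + b"
  define R where "R = \<bar>a 1\<bar> * ((1 + b) / s) powr D"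
  have A: "0 \<le> A" "A * D = A + C" using C D unfolding A_def by (auto simp: field_simps)
  have s: "1 \<le> s" "D \<le> s" using step.hyps b nonneg unfolding s_def by auto
  have R: "0 \<le> R" unfolding R_def by simp
  have factor: "0 \<le> 1 - D / s" using s by simp
  have "a (Suc t) \<le> (1 - D / s) * a t + C / s\<^sup>2"
    using rec step.hyps unfolding s_def by simp
  also have "\<dots> \<le> (1 - D / s) * (A * (1 / s) + R) + C / s\<^sup>2"
    using step.IH factor unfolding A_def s_def R_def by (intro add_right_mono mult_left_mono)
  also have "\<dots> = (A * s - (A * D - C)) / s\<^sup>2 + (1 - D / s) * R"
    using s by (simp add: field_simps power2_eq_square)
  also have "A * s - (A * D - C) = A * (s - 1)" using A(2) by (simp add: algebra_simps)
  also have "A * (s - 1) / s\<^sup>2 \<le> A * (1 / (s + 1))"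
  proof -
    have "(s - 1) / s\<^sup>2 \<le> 1 / (s + 1)" using s by (simp add: field_simps power2_eq_square)
    from mult_left_mono[OF this A(1)] show ?thesis by simp
  qed
  also have "(1 - D / s) * R \<le> \<bar>a 1\<bar> * ((1 + b) / (s + 1)) powr D"
  proof -
    have "ln (1 + 1 / s) \<le> 1 / s" using s by (intro ln_add_one_self_le_self) auto
    then have "D * ln (1 + 1 / s) \<le> D * (1 / s)" using D by (intro mult_left_mono) auto
    then have "1 - D / s \<le> 1 + (- D * ln (1 + 1 / s))" by simp
    also have "\<dots> \<le> exp (- D * ln (1 + 1 / s))" by (rule exp_ge_add_one_self)
    also have "\<dots> = (s / (s + 1)) powr D"
    proof -
      have "1 + 1 / s = (s + 1) / s" using s by (simp add: field_simps)
      then have "ln (1 + 1 / s) = - ln (s / (s + 1))" using s by (simp add: ln_div)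
      then show ?thesis using s by (simp add: powr_def)
    qed
    finally have "(1 - D / s) * R \<le> (s / (s + 1)) powr D * R" using R by (intro mult_right_mono)
    also have "\<dots> = \<bar>a 1\<bar> * ((s / (s + 1)) powr D * ((1 + b) / s) powr D)"
      unfolding R_def by simp
    also have "(s / (s + 1)) powr D * ((1 + b) / s) powr D = ((1 + b) / (s + 1)) powr D"
      using s b by (subst powr_mult[symmetric]) auto
    finally show ?thesis .
  qed
  finally show ?case unfolding A_def s_def by (simp add: add_ac)
qed

lemma powr_decay_smallo:
  fixes D b K :: real
  assumes "1 < D" "0 \<le> b"
  shows "(\<lambda>t::nat. K * ((1 + b) / (real t + b)) powr D) \<in> o(\<lambda>t. 1 / real t)"
  using assms by real_asymp

section \<open>Convergence rates\<close>

theorem theorem5: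
  fixes P :: "'a measure"
    and V :: "real ^ 'n \<Rightarrow> real ^ 'n" and M :: "real ^ 'n ^ 'n" and v :: "real ^ 'n"
    and S :: "(real ^ 'n) set"
    and X Z :: "real \<Rightarrow> 'a \<Rightarrow> real ^ 'n" and x1 :: "real ^ 'n"
    and etas :: "nat \<Rightarrow> real"
    and L \<tau> \<sigma> \<gamma> c \<eta> b C \<Delta> :: real
  assumes "prob_space P"
    and "\<forall>x. V x = M *v x + v"
    and "M \<noteq> 0"
    and "S = {x. V x = 0}" and "S \<noteq> {}"
    and "\<forall>x. \<forall>xs\<in>S. V x \<bullet> (x - xs) \<ge> 0"
    and "L = largest_singular_value M"
    and "\<tau> = smallest_nonzero_singular_value M"
    and "\<sigma> \<ge> 0"
    and "oracle_noise P (history P X) \<sigma> Z"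
    and "0 < c" and "c < 1"
    and "0 < \<gamma>" and "\<gamma> \<le> c / L"
    and "\<eta> > 0"
    and "C = \<eta>\<^sup>2 * (1 + c\<^sup>2) * \<sigma>\<^sup>2"
    and "\<Delta> = \<gamma> * \<eta> * \<tau>\<^sup>2 * (1 - c\<^sup>2)"
    and "dseg P V Z (\<lambda>_. \<gamma>) etas x1 X"
  shows "((\<forall>t\<ge>1. etas t = \<eta>) \<and> \<eta> \<le> \<gamma> \<longrightarrow>
            (\<forall>t\<ge>1. integrable P (\<lambda>\<omega>. (infdist (X (real t) \<omega>) S)\<^sup>2) \<and>
               prob_space.expectation P (\<lambda>\<omega>. (infdist (X (real t) \<omega>) S)\<^sup>2)
                 \<le> (1 - \<Delta>) ^ (t - 1) * (infdist x1 S)\<^sup>2 + C / \<Delta>))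
       \<and> ((\<forall>t\<ge>1. etas t = \<eta> / (real t + b)) \<and> \<eta> > 1 / (\<tau>\<^sup>2 * \<gamma> * (1 - c\<^sup>2)) \<and> b > \<eta> / \<gamma> \<longrightarrow>
            (\<exists>r :: nat \<Rightarrow> real. r \<in> o(\<lambda>t. 1 / real t) \<and>
               (\<forall>t\<ge>1. integrable P (\<lambda>\<omega>. (infdist (X (real t) \<omega>) S)\<^sup>2) \<and>
                  prob_space.expectation P (\<lambda>\<omega>. (infdist (X (real t) \<omega>) S)\<^sup>2)
                    \<le> C / (\<Delta> - 1) * (1 / real t) + r t)))"
proof -
  interpret prob_space P by (rule assms(1))
  have V: "V x = M *v x + v" for x using assms(2) by blast
  have mono: "0 \<le> (M *v y) \<bullet> y" for y
    using monotone_at_zeros_imp_mult_nonneg[OF V assms(4,5)] assms(6) by blast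
  have L: "0 \<le> L" "norm (M *v y) \<le> L * norm y" for y
    using largest_singular_value_bounds[of M] assms(7) by auto
  have \<tau>: "0 < \<tau>" "\<tau> \<le> L"
    "(\<And>k. M *v k = 0 \<Longrightarrow> y \<bullet> k = 0) \<Longrightarrow> \<tau> * norm y \<le> norm (M *v y)" for y
    using smallest_nonzero_singular_value_bounds[OF assms(3)] assms(7,8) by auto
  have \<gamma>L: "\<gamma> * L \<le> c" using \<tau> assms(14) by (simp add: field_simps)
  have c2: "0 < 1 - c\<^sup>2" "1 - c\<^sup>2 \<le> 1"
    using assms(11,12) by (auto simp: power_less_one_iff)
  have \<Delta>_pos: "0 < \<Delta>" using assms(13,15,17) \<tau>(1) c2 by simp
  \<comment> \<open>As \<open>\<gamma> * \<tau> \<le> \<gamma> * L \<le> c < 1\<close>, the factors of both recursions are nonnegative.\<close>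
  have factor: "\<gamma> * \<gamma> * \<tau>\<^sup>2 * (1 - c\<^sup>2) \<le> 1"
  proof -
    have "\<gamma> * \<tau> \<le> 1" using mult_left_mono[OF \<tau>(2), of \<gamma>] \<gamma>L assms(12,13) by linarith
    then have "(\<gamma> * \<tau>)\<^sup>2 \<le> 1" using assms(13) \<tau>(1) by (simp add: power_le_one)
    then have "(\<gamma> * \<tau>)\<^sup>2 * (1 - c\<^sup>2) \<le> 1 * 1" using c2 by (intro mult_mono) auto
    then show ?thesis by (simp add: power2_eq_square algebra_simps)
  qed
  have C: "0 \<le> C" using assms(16) by simp

  have noise: "noise_at P (history P X s) \<sigma> (Z s)" if "s \<in> half_steps" for s
    using assms(10) that unfolding oracle_noise_def noise_at_def by blast
  have V_meas: "V \<in> borel_measurable borel"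
    unfolding ext[of V, OF V] by (intro borel_measurable_continuous_onI continuous_intros)
  have X_meas: "X s \<in> borel_measurable P" if "s \<in> half_steps" for s
    using dseg_borel_measurable[OF assms(18) V_meas _ that] noise
    unfolding noise_at_def by blast
  have sub: "subalgebra P (history P X s)" for s
    using X_meas by (rule history_subalgebra)
  define a where "a t = (\<integral>\<omega>. (infdist (X (real t) \<omega>) S)\<^sup>2 \<partial>P)" for t :: nat
  have X1: "X (real 1) \<omega> = x1" if "\<omega> \<in> space P" for \<omega>
    using assms(18) that by (simp add: dseg_def)
  have int1: "integrable P (\<lambda>\<omega>. (infdist (X (real 1) \<omega>) S)\<^sup>2)"
    by (subst Bochner_Integration.integrable_cong[OF refl, of _ _ "\<lambda>_. (infdist x1 S)\<^sup>2"])
       (simp_all only: X1 integrable_const)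
  have "a 1 = (\<integral>\<omega>. (infdist x1 S)\<^sup>2 \<partial>P)"
    unfolding a_def by (rule Bochner_Integration.integral_cong) (simp_all only: X1)
  then have a1: "a 1 = (infdist x1 S)\<^sup>2" by (simp add: prob_space)
  have step:
    "integrable P (\<lambda>\<omega>. (infdist (X (real (Suc t)) \<omega>) S)\<^sup>2) \<and>
      a (Suc t) \<le> (1 - \<gamma> * etas t * \<tau>\<^sup>2 * (1 - c\<^sup>2)) * a t + (etas t)\<^sup>2 * (1 + c\<^sup>2) * \<sigma>\<^sup>2"
    if t: "t \<ge> 1" and int: "integrable P (\<lambda>\<omega>. (infdist (X (real t) \<omega>) S)\<^sup>2)"
      and etas: "0 \<le> etas t" "etas t \<le> \<gamma>" for t :: nat
  proof -
    note hs = nat_in_half_steps[OF t]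
    have "real (Suc t) \<in> half_steps" by (rule nat_in_half_steps) simp
    note X'_meas = X_meas[OF this]
    have W: "X (real t + 1/2) \<omega> = X (real t) \<omega> - \<gamma> *\<^sub>R (V (X (real t) \<omega>) + Z (real t) \<omega>)"
      and X': "X (real (Suc t)) \<omega>
        = X (real t) \<omega> - etas t *\<^sub>R (V (X (real t + 1/2) \<omega>) + Z (real t + 1/2) \<omega>)"
      if "\<omega> \<in> space P" for \<omega>
      using assms(18) that t unfolding dseg_def by (auto simp: add.commute)
    have c: "0 \<le> c" "c \<le> 1" "0 \<le> \<gamma>" using assms(11,12,13) by auto
    have "X (real t) \<in> borel_measurable (history P X (real t))"
      "X (real t) \<in> borel_measurable (history P X (real t + 1/2))"
      "X (real t + 1/2) \<in> borel_measurable (history P X (real t + 1/2))"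
      using hs by (auto intro: borel_measurable_history)
    from expected_dist_step[OF assms(1) V assms(4,5) mono L(2) less_imp_le[OF \<tau>(1)] \<tau>(3)
        c(1,2,3) L(1) \<gamma>L etas sub sub this noise[OF hs(1)] noise[OF hs(2)] W X' X'_meas int]
    show ?thesis unfolding a_def by blast
  qed
  have int: "integrable P (\<lambda>\<omega>. (infdist (X (real t) \<omega>) S)\<^sup>2)"
    if t: "t \<ge> 1" and etas: "\<And>t. t \<ge> 1 \<Longrightarrow> 0 \<le> etas t \<and> etas t \<le> \<gamma>" for t :: nat
    using t by (induction t rule: dec_induct) (use int1 step etas in auto)
  show ?thesis
    unfolding a_def[symmetric]
  proof (intro conjI impI)
    assume *: "(\<forall>t\<ge>1. etas t = \<eta>) \<and> \<eta> \<le> \<gamma>"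
    then have etas: "0 \<le> etas t \<and> etas t \<le> \<gamma>" if "t \<ge> 1" for t using that assms(15) by auto
    have "\<gamma> * \<eta> * (\<tau>\<^sup>2 * (1 - c\<^sup>2)) \<le> \<gamma> * \<gamma> * (\<tau>\<^sup>2 * (1 - c\<^sup>2))"
      using * assms(13) c2 by (intro mult_right_mono mult_left_mono) auto
    then have \<Delta>_le: "\<Delta> \<le> 1" using factor assms(17) by (simp add: mult.assoc)
    have "a (Suc t) \<le> (1 - \<Delta>) * a t + C" if "t \<ge> 1" for t
      using step[OF that int[OF that etas]] etas[OF that] * that assms(16,17) by auto
    from geometric_recursion_bound[where a = a and D = \<Delta> and C = C, OF this \<Delta>_pos \<Delta>_le C]
    show "\<forall>t\<ge>1. integrable P (\<lambda>\<omega>. (infdist (X (real t) \<omega>) S)\<^sup>2) \<and>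
        a t \<le> (1 - \<Delta>) ^ (t - 1) * (infdist x1 S)\<^sup>2 + C / \<Delta>"
      using int[OF _ etas] a1 by simp
  next
    assume *: "(\<forall>t\<ge>1. etas t = \<eta> / (real t + b)) \<and> \<eta> > 1 / (\<tau>\<^sup>2 * \<gamma> * (1 - c\<^sup>2)) \<and> b > \<eta> / \<gamma>"
    then have \<Delta>: "1 < \<Delta>"
      using assms(13,17) \<tau>(1) c2 by (simp add: field_simps)
    have b: "0 < b" using * assms(13,15) by (meson divide_pos_pos less_trans)
    have \<eta>b: "\<eta> \<le> \<gamma> * (real t + b)" for t :: nat
    proof -
      have "\<eta> \<le> \<gamma> * b" using * assms(13) by (simp add: field_simps)
      also have "\<dots> \<le> \<gamma> * (real t + b)" using assms(13) by simp
      finally show ?thesis .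
    qed
    have etas: "0 \<le> etas t \<and> etas t \<le> \<gamma>" if "t \<ge> 1" for t
      using that * \<eta>b[of t] b assms(15) by (simp add: divide_le_eq)
    have nonneg: "\<Delta> \<le> real t + b" for t :: nat
    proof -
      have "\<Delta> = \<eta> * (\<gamma> * \<tau>\<^sup>2 * (1 - c\<^sup>2))" using assms(17) by simp
      also have "\<dots> \<le> \<gamma> * (real t + b) * (\<gamma> * \<tau>\<^sup>2 * (1 - c\<^sup>2))"
        using \<eta>b assms(13) c2 by (intro mult_right_mono) auto
      also have "\<dots> = (\<gamma> * \<gamma> * \<tau>\<^sup>2 * (1 - c\<^sup>2)) * (real t + b)" by simp
      also have "\<dots> \<le> 1 * (real t + b)" using factor b by (intro mult_right_mono) auto
      finally show ?thesis by simp
    qed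
    have rec: "a (Suc t) \<le> (1 - \<Delta> / (real t + b)) * a t + C / (real t + b)\<^sup>2" if "t \<ge> 1" for t
      using step[OF that int[OF that etas]] etas[OF that] * that assms(16,17)
      by (auto simp: power_divide mult.assoc mult.left_commute)
    define r where "r t = \<bar>a 1\<bar> * ((1 + b) / (real t + b)) powr \<Delta>" for t :: nat
    have "r \<in> o(\<lambda>t. 1 / real t)"
      unfolding r_def using powr_decay_smallo \<Delta> b by simp
    moreover have "a t \<le> C / (\<Delta> - 1) * (1 / real t) + r t" if t: "t \<ge> 1" for t
    proof -
      have "a t \<le> C / (\<Delta> - 1) * (1 / (real t + b)) + r t"
        unfolding r_def using harmonic_recursion_bound[where a = a and D = \<Delta> and C = C and b = b, OF rec \<Delta> nonneg less_imp_le[OF b] C t] .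
      moreover have "C / (\<Delta> - 1) * (1 / (real t + b)) \<le> C / (\<Delta> - 1) * (1 / real t)"
        using C \<Delta> b t by (intro mult_left_mono) (auto simp: frac_le)
      ultimately show ?thesis by linarith
    qed
    ultimately show "\<exists>r. r \<in> o(\<lambda>t. 1 / real t) \<and>
        (\<forall>t\<ge>1. integrable P (\<lambda>\<omega>. (infdist (X (real t) \<omega>) S)\<^sup>2) \<and>
          a t \<le> C / (\<Delta> - 1) * (1 / real t) + r t)"
      using int[OF _ etas] by blast
  qed
qed

end
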